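(* Let $P(\lambda)$ be an $n\times n$ complex matrix polynomial with nonsingular leading coefficient, $w$ a weight polynomial as in the context and $\varepsilon>0$. Suppose $\Lambda_\varepsilon(P)$ is bounded and $\mathcal{G}$ is a connected component of $\Lambda_\varepsilon(P)$. Then $P(\lambda)$ has more than one eigenvalue in $\mathcal{G}$ (counting multiplicities) if and only if there is a perturbation $Q(\lambda)\in\mathcal{B}(P,\varepsilon,w)$ with a multiple eigenvalue in $\mathcal{G}$.
   Context: $P(\lambda)=P_m\lambda^m+\cdots+P_1\lambda+P_0$ with $m\ge 1$, $P_j\in\mathbb{C}^{n\times n}$ and $\det P_m\neq 0$. For a matrix polynomial $Q(\lambda)$, $\mu$ is an eigenvalue if $\det Q(\mu)=0$; its (algebraic) multiplicity is its order as a zero of $\det Q(\lambda)$, and it is a multiple eigenvalue if this order is at least $2$. The weight polynomial is $w(x)=\sum_{j=0}^m w_jx^j$ with real $w_j\ge 0$ for $j=1,\dots,m$ and $w_0>0$. $\|\cdot\|$ is the spectral matrix norm. $\mathcal{B}(P,\varepsilon,w)$ is the set of matrix polynomials $Q(\lambda)=\sum_{j=0}^m(P_j+\Delta_j)\lambda^j$ with $\Delta_j\in\mathbb{C}^{n\times n}$ and $\|\Delta_j\|\le\varepsilon w_j$ for $j=0,\dots,m$. $\Lambda_\varepsilon(P)=\{\mu\in\mathbb{C}:\det Q(\mu)=0\text{ for some }Q\in\mathcal{B}(P,\varepsilon,w)\}$; equivalently $\Lambda_\varepsilon(P)=\{\lambda\in\mathbb{C}: s_n(\lambda)\le\varepsilon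 w(|\lambda|)\}$, where $s_n(\lambda)$ is the smallest singular value of $P(\lambda)$. *)

theory Defs
  imports "HOL-Analysis.Analysis" "HOL-Computational_Algebra.Polynomial" "HOL-Library.Extended_Nat"
begin

text \<open>
  A square matrix polynomial over the complex numbers is represented as a matrix with
  polynomial entries, so that \<^const>\<open>det\<close> of it is the scalar polynomial
  \<open>\<lambda> \<mapsto> det Q(\<lambda>)\<close>.
\<close>

type_synonym 'n matpoly = "complex poly ^ 'n ^ 'n"

definition matpoly_of_coeffs :: "nat \<Rightarrow> (nat \<Rightarrow> complex ^ 'n ^ 'n) \<Rightarrow> 'n matpoly" where
  "matpoly_of_coeffs m C = (\<chi> i k. \<Sum>j\<le>m. monom (C j $ i $ k) j)"

definition matpoly_eval :: "'n matpoly \<Rightarrow> complex \<Rightarrow> complex ^ 'n ^ 'n" where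
  "matpoly_eval Q \<mu> = map_matrix (\<lambda>p. poly p \<mu>) Q"

definition matpoly_eigenvalue :: "'n::finite matpoly \<Rightarrow> complex \<Rightarrow> bool" where
  "matpoly_eigenvalue Q \<mu> \<longleftrightarrow> det (matpoly_eval Q \<mu>) = 0"

text \<open>
  \<^const>\<open>order\<close> is unspecified at the zero polynomial; if \<open>det Q\<close> vanishes identically, every
  point is a zero of infinite order.
\<close>

definition alg_multiplicity :: "'n::finite matpoly \<Rightarrow> complex \<Rightarrow> enat" where
  "alg_multiplicity Q \<mu> = (if det Q = 0 then \<infinity> else enat (order \<mu> (det Q)))"

definition multiple_eigenvalue :: "'n::finite matpoly \<Rightarrow> complex \<Rightarrow> bool" where
  "multiple_eigenvalue Q \<mu> \<longleftrightarrow> matpoly_eigenvalue Q \<mu> \<and> alg_multiplicity Q \<mu> \<ge> 2"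

text \<open>
  Only meaningful if \<open>Q\<close> has finitely many eigenvalues in \<open>S\<close>, in particular
  if \<open>det Q\<close> is not the zero polynomial.
\<close>

definition num_eigenvalues_in :: "'n::finite matpoly \<Rightarrow> complex set \<Rightarrow> enat" where
  "num_eigenvalues_in Q S = (\<Sum>\<mu> | \<mu> \<in> S \<and> matpoly_eigenvalue Q \<mu>. alg_multiplicity Q \<mu>)"

text \<open>The norm on \<^typ>\<open>complex ^ 'n\<close> is the Euclidean one, so its operator norm is the spectral norm.\<close>

definition spectral_norm :: "complex ^ 'n ^ 'n \<Rightarrow> real" where
  "spectral_norm A = onorm ((*v) A)"

definition perturbations ::
    "nat \<Rightarrow> (nat \<Rightarrow> complex ^ 'n ^ 'n) \<Rightarrow> real \<Rightarrow> (nat \<Rightarrow> real) \<Rightarrow> 'n::finite matpoly set" where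
  "perturbations m P \<epsilon> w =
     {matpoly_of_coeffs m (\<lambda>j. P j + \<Delta> j) | \<Delta>. \<forall>j\<le>m. spectral_norm (\<Delta> j) \<le> \<epsilon> * w j}"

definition pseudospectrum ::
    "nat \<Rightarrow> (nat \<Rightarrow> complex ^ 'n ^ 'n) \<Rightarrow> real \<Rightarrow> (nat \<Rightarrow> real) \<Rightarrow> complex set" where
  "pseudospectrum m P \<epsilon> w = {\<mu>. \<exists>Q \<in> perturbations m P \<epsilon> w. matpoly_eigenvalue Q \<mu>}"

end

theory Submission imports Defs "HOL-Complex_Analysis.Residue_Theorem" begin

text \<open>
  Write \<open>\<Lambda>\<close> for the pseudospectrum and \<open>G\<close> for one of its components.

  Suppose \<open>K \<subseteq> \<Lambda>\<close> is compact with \<open>\<Lambda> - K\<close> closed. Along the segment from \<open>P\<close> to a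
  perturbation \<open>Q\<close> every eigenvalue stays in \<open>\<Lambda>\<close>, so none can enter or leave \<open>K\<close>, and Rouche's theorem
  makes the number of eigenvalues in \<open>K\<close> constant (\<open>root_count_perturbation\<close>). By the Sura-Bura
  theorem a component is an intersection of such sets \<open>K\<close>, hence every component contains an
  eigenvalue of \<open>P\<close>. There are therefore finitely many components, and \<open>G\<close> is itself such
  a \<open>K\<close>. This settles one direction: an eigenvalue of \<open>Q\<close> of multiplicity at least two in \<open>G\<close> forces \<open>P\<close> to have
  at least two eigenvalues there.

  Conversely, suppose that no perturbation has a multiple eigenvalue in \<open>G\<close>. It is enough to
  use the perturbations \<open>\<Delta>\<^sub>j = \<epsilon> w\<^sub>j u\<^sup>j E\<close> with \<open>E\<close> a contraction and \<open>u\<close> in the closed unit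
  disc, since these parameters form a convex set \<open>D\<close>. The pairs \<open>((E, u), z)\<close>, with
  \<open>z \<in> G\<close> an eigenvalue of the perturbation given by \<open>(E, u)\<close>, form a covering space
  of \<open>D\<close> because all these eigenvalues are simple (\<open>covering_space_root_bundle\<close>). As \<open>D\<close> is simply
  connected, the covering has a global section. On the other hand, let \<open>Y\<close> be the set of
  those pairs with \<open>\<bar>u\<bar> = 1\<close> and \<open>u z = \<bar>z\<bar>\<close>. For them the perturbed matrix at \<open>z\<close> is
  \<open>P(z) + \<epsilon> w(\<bar>z\<bar>) E\<close>, so \<open>Y\<close> projects onto all of \<open>G\<close>, with fibres given by the contractions \<open>E\<close> that make
  this matrix singular. These fibres are connected (\<open>connected_singular_contractions\<close>), whence
  \<open>Y\<close> is connected. Two lifts which agree at one point of a connected set agree throughout, so \<open>Y\<close>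
  lies in the image of the section. Over \<open>E = 0\<close> this image contains only one
  eigenvalue of \<open>P\<close>, while \<open>Y\<close> contains all eigenvalues of \<open>P\<close> in \<open>G\<close>. Hence \<open>P\<close> has just one eigenvalue in
  \<open>G\<close>, and it is simple.
\<close>

section \<open>Counting the zeros of polynomials with multiplicity\<close>

definition root_count :: "complex poly \<Rightarrow> complex set \<Rightarrow> nat" where
  "root_count p S = (\<Sum>z | z \<in> S \<and> poly p z = 0. order z p)"

lemma zorder_poly:
  fixes p :: "complex poly"
  assumes "p \<noteq> 0"
  shows "zorder (poly p) z = int (order z p)"
proof -
  obtain q where q: "p = [:- z, 1:] ^ order z p * q" "\<not> [:- z, 1:] dvd q"
    using order_decomp[OF assms] by blast
  show ?thesis
  proof (rule zorder_eqI[where S = UNIV and g = "poly q"])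
    show "poly q z \<noteq> 0"
      using q(2) by (simp add: poly_eq_0_iff_dvd)
    fix w assume "w \<noteq> z"
    show "poly p w = poly q w * (w - z) powi int (order z p)"
      by (subst q(1)) (simp add: poly_power)
  qed (auto intro!: holomorphic_intros)
qed

text \<open>
  Rouche's theorem sums winding numbers over all zeros in its domain. For the whole plane and a
  circle, the zeros outside the circle contribute nothing, and those inside contribute their order.
\<close>

lemma root_count_ball_eq_winding_sum:
  assumes "p \<noteq> 0" "r > 0" and no_root: "\<And>z. z \<in> sphere a r \<Longrightarrow> poly p z \<noteq> 0"
  shows "(\<Sum>z\<in>{z\<in>UNIV. poly p z = 0}. winding_number (circlepath a r) z * zorder (poly p) z)
         = of_nat (root_count p (ball a r))"
proof -
  have fin: "finite {z. poly p z = 0}"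
    using assms(1) poly_roots_finite by blast
  have "(\<Sum>z\<in>{z\<in>UNIV. poly p z = 0}. winding_number (circlepath a r) z * zorder (poly p) z)
      = (\<Sum>z | z \<in> ball a r \<and> poly p z = 0. of_nat (order z p))"
  proof (rule sum.mono_neutral_cong_right)
    show "finite {z\<in>UNIV. poly p z = 0}" using fin by simp
    show "\<forall>z\<in>{z\<in>UNIV. poly p z = 0} - {z. z \<in> ball a r \<and> poly p z = 0}.
       winding_number (circlepath a r) z * zorder (poly p) z = 0"
    proof
      fix z assume z: "z \<in> {z\<in>UNIV. poly p z = 0} - {z. z \<in> ball a r \<and> poly p z = 0}"
      then have "z \<notin> cball a r"
        using no_root[of z] by (auto simp: sphere_def)
      then have "winding_number (circlepath a r) z = 0"
        using assms(2) by (intro winding_number_zero_outside[where s = "cball a r"]) auto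
      then show "winding_number (circlepath a r) z * zorder (poly p) z = 0" by simp
    qed
    fix z assume "z \<in> {z. z \<in> ball a r \<and> poly p z = 0}"
    then have "winding_number (circlepath a r) z = 1"
      by (intro winding_number_circlepath) (auto simp: dist_norm norm_minus_commute)
    then show "winding_number (circlepath a r) z * zorder (poly p) z = of_nat (order z p)"
      using zorder_poly[OF assms(1)] by simp
  qed auto
  then show ?thesis by (simp add: root_count_def)
qed

lemma Rouche_root_count:
  assumes "r > 0" "\<And>z. z \<in> sphere a r \<Longrightarrow> cmod (poly q z - poly p z) < cmod (poly p z)"
  shows "root_count q (ball a r) = root_count p (ball a r)"
proof -
  define fg where "fg = (\<lambda>z. poly p z + poly (q - p) z)"
  have fg: "fg = poly q" by (auto simp: fg_def)
  have "\<And>z. z \<in> sphere a r \<Longrightarrow> poly p z \<noteq> 0" "\<And>z. z \<in> sphere a r \<Longrightarrow> poly q z \<noteq> 0"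
    using assms(2) by force+
  note nz = this
  have "a + of_real r \<in> sphere a r" using assms(1) by (simp add: dist_norm)
  then have "p \<noteq> 0" "q \<noteq> 0" using nz by force+
  have fin: "finite {z\<in>UNIV. poly p z = 0}" "finite {z\<in>UNIV. fg z = 0}"
    using \<open>p \<noteq> 0\<close> \<open>q \<noteq> 0\<close> poly_roots_finite by (auto simp: fg)
  have "(\<Sum>z\<in>{z\<in>UNIV. fg z = 0}. winding_number (circlepath a r) z * zorder fg z)
      = (\<Sum>z\<in>{z\<in>UNIV. poly p z = 0}. winding_number (circlepath a r) z * zorder (poly p) z)"
    using fin assms unfolding fg_def
    by (intro Rouche_theorem) (auto intro!: holomorphic_intros)
  then have "of_nat (root_count q (ball a r)) = (of_nat (root_count p (ball a r)) :: complex)"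
    unfolding fg
    by (subst (asm) (1 2) root_count_ball_eq_winding_sum) (use \<open>p \<noteq> 0\<close> \<open>q \<noteq> 0\<close> nz assms in auto)
  then show ?thesis by simp
qed

text \<open>
  The roots of a continuous family of polynomials are confined to two disjoint closed sets \<open>K\<close> and
  \<open>L\<close>. Thus no root can reach \<open>K\<close> from outside, and near a parameter \<open>x0\<close> the roots in \<open>K\<close> are
  governed by those of \<open>p x0\<close>: on small circles around these, and on the part of \<open>K\<close> outside the circles,
  \<open>p x0\<close> is bounded away from zero, which excludes further roots and lets Rouche's theorem
  count the roots inside each circle.
\<close>

lemma local_root_structure:
  fixes p :: "'a::topological_space \<Rightarrow> complex poly"
  assumes cont: "continuous_on (D \<times> UNIV) (\<lambda>(x, z). poly (p x) z)"
    and K: "compact K" and L: "closed L" and KL: "K \<inter> L = {}"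
    and roots: "\<forall>x\<in>D. {z. poly (p x) z = 0} \<subseteq> K \<union> L"
    and x0: "x0 \<in> D" and nz: "p x0 \<noteq> 0" and "\<rho> > 0"
    and R_def: "R = {c \<in> K. poly (p x0) c = 0}"
  obtains r T where "0 < r" "r \<le> \<rho>" "open T" "x0 \<in> T"
    "disjoint_family_on (\<lambda>c. ball c r) R"
    "\<And>x c. x \<in> T \<Longrightarrow> x \<in> D \<Longrightarrow> c \<in> R \<Longrightarrow>
       root_count (p x) (ball c r) = order c (p x0)"
    "\<And>x. x \<in> T \<Longrightarrow> x \<in> D \<Longrightarrow> {z \<in> K. poly (p x) z = 0} =
       (\<Union>c\<in>R. {z \<in> ball c r. poly (p x) z = 0})"
proof -
  have finR: "finite R"
    using poly_roots_finite[OF nz] by (simp add: R_def)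
  define d where "d = Min (insert 1 ((\<lambda>(a, b). dist a b) ` {(a, b) \<in> R \<times> R. a \<noteq> b}))"
  have fin': "finite (insert 1 ((\<lambda>(a, b). dist a b) ` {(a, b) \<in> R \<times> R. a \<noteq> b}))"
    using finite_subset[OF _ finite_cartesian_product[OF finR finR], of "{(a, b) \<in> R \<times> R. a \<noteq> b}"]
    by blast
  have d: "d > 0" "\<And>a b. a \<in> R \<Longrightarrow> b \<in> R \<Longrightarrow> a \<noteq> b \<Longrightarrow> d \<le> dist a b"
  proof -
    show "d > 0"
      unfolding d_def Min_gr_iff[OF fin' insert_not_empty] by auto
    show "d \<le> dist a b" if "a \<in> R" "b \<in> R" "a \<noteq> b" for a b
      unfolding d_def by (rule Min_le[OF fin']) (use that in force)
  qed
  obtain e where e: "e > 0" "\<And>a b. a \<in> K \<Longrightarrow> b \<in> L \<Longrightarrow> e \<le> dist a b"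
    using separate_compact_closed[OF K L KL] by blast
  define r where "r = min \<rho> (min (d / 2) (e / 2))"
  have r: "0 < r" "r \<le> \<rho>" "2 * r \<le> d" "r < e"
    using \<open>\<rho> > 0\<close> d e by (auto simp: r_def)
  have disj: "ball a r \<inter> ball b r = {}" if "a \<in> R" "b \<in> R" "a \<noteq> b" for a b
    using d(2)[OF that] r by (intro disjoint_ballI) auto
  have near_K: "z \<in> K" if "x \<in> D" "poly (p x) z = 0" "c \<in> R" "dist c z \<le> r" for x z c
    using roots e(2)[of c z] that r by (auto simp: R_def)
  \<comment> \<open>The compact set on which \<open>p x\<close> has to stay close to \<open>p x0\<close>.\<close>
  define C where "C = (\<Union>c\<in>R. sphere c r) \<union> (K - (\<Union>c\<in>R. ball c r))"
  have "compact C"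
    unfolding C_def using finR K by (intro compact_Un compact_UN compact_diff) auto
  have C_nz: "poly (p x0) z \<noteq> 0" if "z \<in> C" for z
  proof
    assume z: "poly (p x0) z = 0"
    from that consider c where "c \<in> R" "dist c z = r" | "z \<in> K" "z \<notin> (\<Union>c\<in>R. ball c r)"
      by (auto simp: C_def)
    then show False
    proof cases
      case 1
      then have "z \<in> R" "z \<noteq> c"
        using near_K[OF x0 z] z r by (auto simp: R_def)
      then show False
        using d(2)[of c z] 1 r by auto
    next
      case 2
      then show False using z r(1) by (auto simp: R_def)
    qed
  qed
  obtain \<eta> where \<eta>: "\<eta> > 0" "\<And>z. z \<in> C \<Longrightarrow> \<eta> \<le> cmod (poly (p x0) z)"
  proof (cases "C = {}")
    case False
    obtain z where "z \<in> C" "\<And>y. y \<in> C \<Longrightarrow> cmod (poly (p x0) z) \<le> cmod (poly (p x0) y)"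
      using continuous_attains_inf[OF \<open>compact C\<close> False, of "\<lambda>z. cmod (poly (p x0) z)"]
      by (force intro: continuous_intros)
    then show ?thesis using C_nz that[of "cmod (poly (p x0) z)"] by auto
  qed (use that[of 1] in auto)
  have contC: "continuous_on (D \<times> C) (\<lambda>(x, z). poly (p x) z)"
    by (rule continuous_on_subset[OF cont]) auto
  obtain T where T: "x0 \<in> T" "open T"
    and T': "\<forall>x\<in>T \<inter> D. \<forall>z\<in>C. dist (poly (p x) z) (poly (p x0) z) \<le> \<eta> / 2"
    using continuous_on_prod_compactE[OF contC \<open>compact C\<close> x0 half_gt_zero[OF \<eta>(1)]]
    unfolding prod.case by blast
  have close: "cmod (poly (p x) z - poly (p x0) z) < cmod (poly (p x0) z)"
    if "x \<in> T" "x \<in> D" "z \<in> C" for x z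
  proof -
    have "dist (poly (p x) z) (poly (p x0) z) \<le> \<eta> / 2"
      using T' that by blast
    then show ?thesis using \<eta>(2)[OF that(3)] \<eta>(1) by (simp add: dist_norm)
  qed
  have count: "root_count (p x) (ball c r) = order c (p x0)"
    if "x \<in> T" "x \<in> D" "c \<in> R" for x c
  proof -
    have "root_count (p x) (ball c r) = root_count (p x0) (ball c r)"
      using r(1) close that by (intro Rouche_root_count) (auto simp: C_def)
    also have "{z. z \<in> ball c r \<and> poly (p x0) z = 0} = {c}"
    proof -
      have "z = c" if "z \<in> ball c r" "poly (p x0) z = 0" for z
      proof (rule ccontr)
        assume "z \<noteq> c"
        moreover have "z \<in> R" using near_K[OF x0 that(2) \<open>c \<in> R\<close>] that by (auto simp: R_def)
        moreover have "z \<in> ball z r \<inter> ball c r" using that r by simp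
        ultimately show False using disj[of z c] \<open>c \<in> R\<close> by blast
      qed
      then show ?thesis using \<open>c \<in> R\<close> r by (auto simp: R_def)
    qed
    then have "root_count (p x0) (ball c r) = order c (p x0)"
      by (simp add: root_count_def)
    finally show ?thesis .
  qed
  have cover: "z \<in> (\<Union>c\<in>R. ball c r)" if "x \<in> T" "x \<in> D" "z \<in> K" "poly (p x) z = 0" for x z
  proof (rule ccontr)
    assume "z \<notin> (\<Union>c\<in>R. ball c r)"
    then have "z \<in> C" using that by (auto simp: C_def)
    then show False using close[OF that(1,2)] that(4) by force
  qed
  show ?thesis
  proof (rule that[of r T])
    show "disjoint_family_on (\<lambda>c. ball c r) R"
      using disj by (auto simp: disjoint_family_on_def R_def)
    show "root_count (p x) (ball c r) = order c (p x0)"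
      if "x \<in> T" "x \<in> D" "c \<in> R" for x c
      using count that by (auto simp: R_def)
    show "{z \<in> K. poly (p x) z = 0} =
       (\<Union>c\<in>R. {z \<in> ball c r. poly (p x) z = 0})"
      if "x \<in> T" "x \<in> D" for x
    proof (intro equalityI subsetI)
      fix z assume "z \<in> {z \<in> K. poly (p x) z = 0}"
      then show "z \<in> (\<Union>c\<in>R. {z \<in> ball c r. poly (p x) z = 0})"
        using cover[OF that] by blast
    next
      fix z assume "z \<in> (\<Union>c\<in>R. {z \<in> ball c r. poly (p x) z = 0})"
      then obtain c where "c \<in> R" "dist c z < r" "poly (p x) z = 0" by auto
      then show "z \<in> {z \<in> K. poly (p x) z = 0}"
        using near_K[OF that(2)] by auto
    qed
  qed (use r T in auto)
qed

lemma root_count_constant: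
  fixes p :: "'a::topological_space \<Rightarrow> complex poly"
  assumes cont: "continuous_on (D \<times> UNIV) (\<lambda>(x, z). poly (p x) z)"
    and D: "connected D"
    and K: "compact K" "closed L" "K \<inter> L = {}"
    and roots: "\<forall>x\<in>D. {z. poly (p x) z = 0} \<subseteq> K \<union> L"
    and nz: "\<And>x. x \<in> D \<Longrightarrow> p x \<noteq> 0"
    and "x \<in> D" "y \<in> D"
  shows "root_count (p x) K = root_count (p y) K"
proof (rule connected_local_const[OF D \<open>x \<in> D\<close> \<open>y \<in> D\<close>], rule ballI)
  fix x0 assume x0: "x0 \<in> D"
  define R where "R = {c \<in> K. poly (p x0) c = 0}"
  obtain r T where T: "0 < r" "r \<le> 1" "open T" "x0 \<in> T"
    and disj: "disjoint_family_on (\<lambda>c. ball c r) R"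
    and count: "\<And>x c. x \<in> T \<Longrightarrow> x \<in> D \<Longrightarrow> c \<in> R \<Longrightarrow> root_count (p x) (ball c r) = order c (p x0)"
    and eq: "\<And>x. x \<in> T \<Longrightarrow> x \<in> D \<Longrightarrow> {z \<in> K. poly (p x) z = 0} = (\<Union>c\<in>R. {z \<in> ball c r. poly (p x) z = 0})"
    by (fact local_root_structure[OF cont K roots x0 nz[OF x0] zero_less_one R_def])
  have "root_count (p x) K = (\<Sum>c\<in>R. order c (p x0))" if x: "x \<in> T" "x \<in> D" for x
  proof -
    have "root_count (p x) K = (\<Sum>z\<in>(\<Union>c\<in>R. {z \<in> ball c r. poly (p x) z = 0}). order z (p x))"
      by (simp add: root_count_def eq[OF x])
    also have "\<dots> = (\<Sum>c\<in>R. root_count (p x) (ball c r))"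
      unfolding root_count_def
    proof (rule sum.UNION_disjoint)
      show "finite R" using poly_roots_finite[OF nz[OF x0]] by (simp add: R_def)
      show "\<forall>c\<in>R. finite {z \<in> ball c r. poly (p x) z = 0}"
        using poly_roots_finite[OF nz[OF x(2)]] by simp
      show "\<forall>a\<in>R. \<forall>b\<in>R. a \<noteq> b \<longrightarrow> {z \<in> ball a r. poly (p x) z = 0} \<inter> {z \<in> ball b r. poly (p x) z = 0} = {}"
        using disj by (fastforce simp: disjoint_family_on_def)
    qed
    finally show ?thesis using count[OF x] by simp
  qed
  then have "\<forall>x\<in>T. x \<in> D \<longrightarrow> root_count (p x0) K = root_count (p x) K"
    using T x0 by simp
  then show "\<forall>\<^sub>F x in at x0 within D. root_count (p x0) K = root_count (p x) K"
    using T by (auto simp: eventually_at_topological)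
qed

section \<open>The covering space formed by simple roots\<close>

lemma root_count_eq_1:
  assumes "p \<noteq> 0" "root_count p S = 1"
  shows "\<exists>!z. z \<in> S \<and> poly p z = 0"
proof -
  have fin: "finite {z. z \<in> S \<and> poly p z = 0}"
    using poly_roots_finite[OF assms(1)] by simp
  obtain a where a: "a \<in> {z. z \<in> S \<and> poly p z = 0}"
    "\<forall>b\<in>{z. z \<in> S \<and> poly p z = 0}. a \<noteq> b \<longrightarrow> order b p = 0"
    using assms(2) unfolding root_count_def sum_eq_1_iff[OF fin] by blast
  have "b = a" if "b \<in> S" "poly p b = 0" for b
    using a(2) that order_root[of p b] assms(1) by auto
  then show ?thesis using a(1) by blast
qed

text \<open>
  The graph of the multivalued root function, as a subset of parameter space times the plane.
\<close>

definition root_bundle :: "('a \<Rightarrow> complex poly) \<Rightarrow> 'a set \<Rightarrow> complex set \<Rightarrow> ('a \<times> complex) set" where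
  "root_bundle p D K = {(x, z). x \<in> D \<and> z \<in> K \<and> poly (p x) z = 0}"

text \<open>
  For simple roots the count of \<open>local_root_structure\<close> is one in each disc, so over a
  neighbourhood \<open>T\<close> of a parameter each disc contributes one sheet, the graph of a root function. The
  same count in arbitrarily small discs gives the continuity of this function.
\<close>

lemma covering_space_root_bundle:
  fixes p :: "'a::metric_space \<Rightarrow> complex poly"
  assumes cont: "continuous_on (D \<times> UNIV) (\<lambda>(x, z). poly (p x) z)"
    and K: "compact K" "closed L" "K \<inter> L = {}"
    and roots: "\<forall>x\<in>D. {z. poly (p x) z = 0} \<subseteq> K \<union> L"
    and nz: "\<And>x. x \<in> D \<Longrightarrow> p x \<noteq> 0"
    and simple: "\<And>x z. (x, z) \<in> root_bundle p D K \<Longrightarrow> order z (p x) = 1"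
    and ex: "\<And>x. x \<in> D \<Longrightarrow> \<exists>z\<in>K. poly (p x) z = 0"
  shows "covering_space (root_bundle p D K) fst D"
proof (rule covering_spaceI)
  show "continuous_on (root_bundle p D K) fst" by (intro continuous_intros)
  show "fst ` root_bundle p D K = D"
    using ex by (force simp: root_bundle_def)
  fix x0 assume x0: "x0 \<in> D"
  define R where "R = {c \<in> K. poly (p x0) c = 0}"
  obtain r T where T: "0 < r" "r \<le> 1" "open T" "x0 \<in> T"
    and disj: "disjoint_family_on (\<lambda>c. ball c r) R"
    and count: "\<And>x c. x \<in> T \<Longrightarrow> x \<in> D \<Longrightarrow> c \<in> R \<Longrightarrow> root_count (p x) (ball c r) = order c (p x0)"
    and eq: "\<And>x. x \<in> T \<Longrightarrow> x \<in> D \<Longrightarrow> {z \<in> K. poly (p x) z = 0} = (\<Union>c\<in>R. {z \<in> ball c r. poly (p x) z = 0})"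
    by (fact local_root_structure[OF cont K roots x0 nz[OF x0] zero_less_one R_def])
  define V where "V c = root_bundle p D K \<inter> T \<times> ball c r" for c
  have unique: "\<exists>!z. z \<in> ball c r \<and> poly (p x) z = 0" if "x \<in> T" "x \<in> D" "c \<in> R" for x c
  proof (rule root_count_eq_1[OF nz[OF that(2)]])
    have "order c (p x0) = 1" using simple that x0 by (auto simp: R_def root_bundle_def)
    then show "root_count (p x) (ball c r) = 1" using count[OF that] by simp
  qed
  have sheet: "\<exists>q. homeomorphism (V c) (D \<inter> T) fst q" if c: "c \<in> R" for c
  proof -
    define s where "s x = (THE z. z \<in> ball c r \<and> poly (p x) z = 0)" for x
    have s: "s x \<in> ball c r" "poly (p x) (s x) = 0" "s x \<in> K" if "x \<in> D \<inter> T" for x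
    proof -
      show *: "s x \<in> ball c r" "poly (p x) (s x) = 0"
        using theI'[OF unique, of x c] that c by (auto simp: s_def)
      show "s x \<in> K" using eq[of x] * that c by blast
    qed
    have s_eq: "z = s x" if "x \<in> D \<inter> T" "z \<in> ball c r" "poly (p x) z = 0" for x z
      using unique[of x c] s[of x] that c by blast
    have "continuous_on (D \<inter> T) s"
      unfolding continuous_on_iff
    proof (intro ballI allI impI)
      fix x1 and e :: real assume x1: "x1 \<in> D \<inter> T" and "e > 0"
      \<comment> \<open>Within distance \<open>\<rho>\<close> of \<open>s x1\<close> a root still lies in the disc of the sheet.\<close>
      define \<rho> where "\<rho> = min e (r - dist c (s x1))"
      have "\<rho> > 0" using s[OF x1] \<open>e > 0\<close> by (simp add: \<rho>_def)
      define R1 where "R1 = {b \<in> K. poly (p x1) b = 0}"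
      have D1: "x1 \<in> D" using x1 by simp
      obtain r1 T1 where T1: "0 < r1" "r1 \<le> \<rho>" "open T1" "x1 \<in> T1"
        and "disjoint_family_on (\<lambda>c. ball c r1) R1"
        and count1: "\<And>x c. x \<in> T1 \<Longrightarrow> x \<in> D \<Longrightarrow> c \<in> R1 \<Longrightarrow> root_count (p x) (ball c r1) = order c (p x1)"
        and "\<And>x. x \<in> T1 \<Longrightarrow> x \<in> D \<Longrightarrow> {z \<in> K. poly (p x) z = 0} = (\<Union>c\<in>R1. {z \<in> ball c r1. poly (p x) z = 0})"
        by (fact local_root_structure[OF cont K roots D1 nz[OF D1] \<open>\<rho> > 0\<close> R1_def])
      have near: "dist (s x) (s x1) < e" if x: "x \<in> D \<inter> T" "x \<in> T1" for x
      proof -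
        have "order (s x1) (p x1) = 1"
          using simple s[OF x1] D1 by (simp add: root_bundle_def)
        moreover have "s x1 \<in> R1" using s[OF x1] by (simp add: R1_def)
        ultimately have "root_count (p x) (ball (s x1) r1) = 1"
          using count1[of x "s x1"] x by simp
        then obtain z where z: "dist (s x1) z < r1" "poly (p x) z = 0"
          using root_count_eq_1[of "p x"] nz x by (metis IntD1 mem_ball)
        have "dist c z \<le> dist c (s x1) + dist (s x1) z" by (rule dist_triangle)
        then have "dist c z < r" using z T1 by (simp add: \<rho>_def)
        then have "z = s x" using s_eq x z by simp
        then show ?thesis using z T1 by (simp add: \<rho>_def dist_commute)
      qed
      obtain d where "d > 0" "ball x1 d \<subseteq> T1"
        using T1 openE by blast
      then show "\<exists>d>0. \<forall>x\<in>D \<inter> T. dist x x1 < d \<longrightarrow> dist (s x) (s x1) < e"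
        using near by (metis dist_commute mem_ball subsetD)
    qed
    then have "homeomorphism (V c) (D \<inter> T) fst (\<lambda>x. (x, s x))"
      using s s_eq
      by (intro homeomorphismI)
        (auto simp: V_def root_bundle_def intro!: continuous_intros)
    then show ?thesis by blast
  qed
  show "\<exists>t. x0 \<in> t \<and> openin (top_of_set D) t \<and>
          (\<exists>v. \<Union>v = root_bundle p D K \<inter> fst -` t \<and>
            (\<forall>u\<in>v. openin (top_of_set (root_bundle p D K)) u) \<and>
            pairwise disjnt v \<and> (\<forall>u\<in>v. \<exists>q. homeomorphism u t fst q))"
  proof (intro exI conjI)
    show "x0 \<in> D \<inter> T" using x0 T by simp
    show "openin (top_of_set D) (D \<inter> T)" using T by (simp add: openin_open_Int)
    show "\<Union>(V ` R) = root_bundle p D K \<inter> fst -` (D \<inter> T)"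
    proof (intro equalityI subsetI)
      fix y assume y: "y \<in> root_bundle p D K \<inter> fst -` (D \<inter> T)"
      then have "snd y \<in> {z \<in> K. poly (p (fst y)) z = 0}" by (auto simp: root_bundle_def)
      then obtain c where "c \<in> R" "snd y \<in> ball c r"
        using eq[of "fst y"] y by auto
      then show "y \<in> \<Union>(V ` R)" using y by (auto simp: V_def mem_Times_iff)
    qed (auto simp: V_def root_bundle_def)
    show "\<forall>u\<in>V ` R. openin (top_of_set (root_bundle p D K)) u"
      using T by (auto simp: V_def intro!: openin_open_Int open_Times)
    show "pairwise disjnt (V ` R)"
      using disj by (fastforce simp: pairwise_def disjnt_def V_def disjoint_family_on_def)
    show "\<forall>u\<in>V ` R. \<exists>q. homeomorphism u (D \<inter> T) fst q"
      using sheet by blast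
  qed
qed

section \<open>Contractions that make a matrix singular\<close>

lemma singular_iff_kernel:
  fixes A :: "'a::field ^ 'n ^ 'n"
  shows "det A = 0 \<longleftrightarrow> (\<exists>x. x \<noteq> 0 \<and> A *v x = 0)"
  using invertible_det_nz[of A] invertible_left_inverse[of A] matrix_left_invertible_ker[of A]
  by auto

lemma continuous_on_det:
  fixes f :: "'a::topological_space \<Rightarrow> complex ^ 'n ^ 'n"
  assumes "\<And>i k. continuous_on S (\<lambda>x. f x $ i $ k)"
  shows "continuous_on S (\<lambda>x. det (f x))"
  unfolding det_def by (intro continuous_intros assms)

lemma poly_det: "poly (det Q) z = det (matpoly_eval Q z)"
  by (simp add: det_def matpoly_eval_def poly_sum poly_prod)

lemma norm_cmult_vec: "norm (\<chi> i. c * x $ i) = cmod c * norm (x :: complex ^ 'n)"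
  by (simp add: norm_vec_def norm_mult L2_set_right_distrib)

lemma matrix_vector_cmult: "(\<chi> i k. c * A $ i $ k) *v x = (\<chi> i. c * (A *v x) $ i)"
  for A :: "complex ^ 'n ^ 'n"
  by (simp add: matrix_vector_mult_def sum_distrib_left mult.assoc vec_eq_iff)

lemma scaleR_matrix_mult_vec: "(c *\<^sub>R A) *v x = c *\<^sub>R (A *v x)"
  for A :: "complex ^ 'n ^ 'n"
  by (simp add: matrix_vector_mult_def scaleR_sum_right vec_eq_iff)

lemma matrix_mult_scaleR_vec: "A *v (c *\<^sub>R x) = c *\<^sub>R (A *v x)"
  for A :: "complex ^ 'n ^ 'n"
  by (simp add: matrix_vector_mult_def scaleR_sum_right vec_eq_iff)

lemma spectral_norm_le_iff:
  fixes A :: "complex ^ 'n ^ 'n"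
  shows "spectral_norm A \<le> c \<longleftrightarrow> (\<forall>x. norm (A *v x) \<le> c * norm x)"
proof
  assume "spectral_norm A \<le> c"
  then show "\<forall>x. norm (A *v x) \<le> c * norm x"
    unfolding spectral_norm_def
    by (meson matrix_vector_mul_bounded_linear mult_right_mono norm_ge_zero onorm order_trans)
next
  assume "\<forall>x. norm (A *v x) \<le> c * norm x"
  then show "spectral_norm A \<le> c"
    unfolding spectral_norm_def by (intro onorm_le) auto
qed

definition contractions :: "(complex ^ 'n ^ 'n) set" where
  "contractions = {E. \<forall>x. norm (E *v x) \<le> norm x}"

lemma zero_in_contractions: "0 \<in> contractions"
  by (simp add: contractions_def)

lemma convex_contractions: "convex (contractions :: (complex ^ 'n ^ 'n) set)"
proof (rule convexI)
  fix E F :: "complex ^ 'n ^ 'n" and u v :: real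
  assume E: "E \<in> contractions" "F \<in> contractions" and uv: "0 \<le> u" "0 \<le> v" "u + v = 1"
  have "norm ((u *\<^sub>R E + v *\<^sub>R F) *v x) \<le> norm x" for x
  proof -
    have "norm ((u *\<^sub>R E + v *\<^sub>R F) *v x) \<le> u * norm (E *v x) + v * norm (F *v x)"
      using norm_triangle_ineq[of "u *\<^sub>R (E *v x)" "v *\<^sub>R (F *v x)"] uv
      by (simp add: matrix_vector_mult_add_rdistrib scaleR_matrix_mult_vec)
    also have "\<dots> \<le> u * norm x + v * norm x"
      using E uv by (intro add_mono mult_left_mono) (auto simp: contractions_def)
    finally show ?thesis using uv by (simp flip: distrib_right)
  qed
  then show "u *\<^sub>R E + v *\<^sub>R F \<in> contractions" by (simp add: contractions_def)
qed

lemma compact_contractions: "compact (contractions :: (complex ^ 'n ^ 'n) set)"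
proof -
  have "closed (\<Inter>x. {E :: complex ^ 'n ^ 'n. norm (E *v x) \<le> norm x})"
    by (intro closed_INT ballI closed_Collect_le continuous_intros)
      (auto simp: matrix_vector_mult_def intro!: continuous_intros continuous_on_vec_lambda)
  moreover have "(\<Inter>x. {E :: complex ^ 'n ^ 'n. norm (E *v x) \<le> norm x}) = contractions"
    by (auto simp: contractions_def)
  moreover have "norm E \<le> (\<Sum>i\<in>(UNIV :: 'n set). \<Sum>k\<in>(UNIV :: 'n set). 1)"
    if E: "E \<in> contractions" for E :: "complex ^ 'n ^ 'n"
  proof -
    have "cmod (E $ i $ k) \<le> 1" for i k
    proof -
      have "cmod (E $ i $ k) = cmod ((E *v axis k 1) $ i)"
        by (simp add: matrix_vector_mult_def axis_def if_distrib cong: if_cong)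
      also have "\<dots> \<le> norm (E *v axis k 1)" by (rule Finite_Cartesian_Product.norm_nth_le)
      also have "\<dots> \<le> norm (axis k (1 :: complex) :: complex ^ 'n)"
        using E unfolding contractions_def by blast
      also have "norm (axis k (1 :: complex) :: complex ^ 'n) = 1"
        by (simp add: norm_vec_def L2_set_def axis_def if_distrib[where f = "\<lambda>x. (cmod x)\<^sup>2"] cong: if_cong)
      finally show ?thesis .
    qed
    then have "norm (E $ i) \<le> (\<Sum>k\<in>(UNIV :: 'n set). 1)" for i
      unfolding norm_vec_def[of "E $ i"]
      by (intro order_trans[OF L2_set_le_sum] sum_mono) auto
    then show ?thesis
      unfolding norm_vec_def[of E]
      by (intro order_trans[OF L2_set_le_sum] sum_mono) auto
  qed
  then have "bounded (contractions :: (complex ^ 'n ^ 'n) set)"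
    unfolding bounded_iff by blast
  ultimately show ?thesis by (simp add: compact_eq_bounded_closed)
qed

lemma cmod_hermitian_product_le:
  fixes v w :: "complex ^ 'n"
  shows "cmod (\<Sum>k\<in>UNIV. cnj (v $ k) * w $ k) \<le> norm v * norm w"
proof -
  have "cmod (\<Sum>k\<in>UNIV. cnj (v $ k) * w $ k) \<le> (\<Sum>k\<in>UNIV. \<bar>cmod (v $ k)\<bar> * \<bar>cmod (w $ k)\<bar>)"
    by (rule order_trans[OF norm_sum]) (simp add: norm_mult)
  also have "\<dots> \<le> norm v * norm w"
    unfolding norm_vec_def by (rule L2_set_mult_ineq)
  finally show ?thesis .
qed

lemma hermitian_square: "(\<Sum>k\<in>UNIV. cnj (v $ k) * v $ k) = of_real ((norm v)\<^sup>2)"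
  for v :: "complex ^ 'n"
proof -
  have "(norm v)\<^sup>2 = (\<Sum>k\<in>UNIV. (cmod (v $ k))\<^sup>2)"
    by (simp add: norm_vec_def L2_set_def sum_nonneg)
  then show ?thesis
    by (simp add: complex_norm_square mult.commute[of "cnj _"] flip: of_real_power)
qed

text \<open>
  The matrix of \<open>x \<mapsto> (v\<^sup>* x / \<parallel>v\<parallel>\<^sup>2) b\<close>. It maps \<open>v\<close> to \<open>b\<close> with the least possible
  norm \<open>\<parallel>b\<parallel> / \<parallel>v\<parallel>\<close>, and it depends continuously on \<open>v \<noteq> 0\<close> and \<open>b\<close>.
\<close>

definition rank_one_map :: "complex ^ 'n \<Rightarrow> complex ^ 'n \<Rightarrow> complex ^ 'n ^ 'n" where
  "rank_one_map v b = (\<chi> i k. b $ i * cnj (v $ k) / of_real ((norm v)\<^sup>2))"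

lemma rank_one_map_mult:
  "rank_one_map v b *v x = (\<chi> i. ((\<Sum>k\<in>UNIV. cnj (v $ k) * x $ k) / of_real ((norm v)\<^sup>2)) * b $ i)"
  by (simp add: rank_one_map_def matrix_vector_mult_def vec_eq_iff sum_distrib_left sum_distrib_right
      sum_divide_distrib mult_ac)

lemma rank_one_map_self: "v \<noteq> 0 \<Longrightarrow> rank_one_map v b *v v = b"
  by (simp add: rank_one_map_mult hermitian_square vec_lambda_eta)

lemma rank_one_map_contraction:
  assumes "v \<noteq> 0" "norm b \<le> norm v"
  shows "rank_one_map v b \<in> contractions"
  unfolding contractions_def
proof (intro CollectI allI)
  fix x
  have nv: "norm v > 0" using assms by simp
  have "norm (rank_one_map v b *v x) = cmod (\<Sum>k\<in>UNIV. cnj (v $ k) * x $ k) / (norm v)\<^sup>2 * norm b"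
    unfolding rank_one_map_mult norm_cmult_vec by (simp add: norm_divide norm_power)
  also have "\<dots> \<le> (norm v * norm x) / (norm v)\<^sup>2 * norm v"
    using assms cmod_hermitian_product_le[of v x]
    by (intro mult_mono divide_right_mono) auto
  also have "\<dots> = norm x"
    using nv by (simp add: power2_eq_square)
  finally show "norm (rank_one_map v b *v x) \<le> norm x" .
qed

text \<open>
  For \<open>x \<noteq> 0\<close> the contractions \<open>E\<close> with \<open>(A + r E) x = 0\<close> form a convex set \<open>C x\<close>, which is nonempty
  precisely if \<open>\<parallel>A x\<parallel> \<le> r \<parallel>x\<parallel>\<close>, that is, if the quadratic form \<open>B x x = \<parallel>A x\<parallel>\<^sup>2 - r\<^sup>2 \<parallel>x\<parallel>\<^sup>2\<close> is not
  positive. Let \<open>x\<close> and \<open>y\<close> be two such vectors. Since \<open>C (- y) = C y\<close>, the sign of \<open>y\<close> may be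
  chosen such that \<open>B x y \<le> 0\<close>. Then the form is not positive on the whole segment from \<open>x\<close> to \<open>y\<close>,
  and the rank-one elements of the sets \<open>C z\<close> for \<open>z\<close> on the segment connect \<open>C x\<close> with \<open>C y\<close>. A segment through
  \<open>0\<close> is harmless, as \<open>x\<close> and \<open>y\<close> are then parallel and \<open>C x = C y\<close>.
\<close>

lemma connected_singular_contractions:
  fixes A :: "complex ^ 'n ^ 'n" and r :: real
  assumes r: "r > 0"
  shows "connected {E \<in> contractions. det (A + r *\<^sub>R E) = 0}" (is "connected ?S")
proof -
  define C where "C x = {E \<in> contractions. (A + r *\<^sub>R E) *v x = 0}" for x
  have C_iff: "E \<in> C x \<longleftrightarrow> E \<in> contractions \<and> A *v x = - r *\<^sub>R (E *v x)" for E x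
    by (auto simp: C_def matrix_vector_mult_add_rdistrib scaleR_matrix_mult_vec eq_neg_iff_add_eq_0)
  have C_sub: "C x \<subseteq> ?S" if "x \<noteq> 0" for x
    using that by (auto simp: C_def singular_iff_kernel)
  have C_conn: "connected (C x)" for x
  proof (rule convex_connected, rule convexI)
    fix E F :: "complex ^ 'n ^ 'n" and u v :: real
    assume E: "E \<in> C x" "F \<in> C x" and uv: "0 \<le> u" "0 \<le> v" "u + v = 1"
    have "- r *\<^sub>R ((u *\<^sub>R E + v *\<^sub>R F) *v x) = u *\<^sub>R (- r *\<^sub>R (E *v x)) + v *\<^sub>R (- r *\<^sub>R (F *v x))"
      by (simp add: matrix_vector_mult_add_rdistrib scaleR_matrix_mult_vec algebra_simps)
    also have "\<dots> = (u + v) *\<^sub>R (A *v x)"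
      using E by (simp only: C_iff scaleR_left_distrib flip: conjunct2[OF E(1)[unfolded C_iff]] conjunct2[OF E(2)[unfolded C_iff]])
    finally have "A *v x = - r *\<^sub>R ((u *\<^sub>R E + v *\<^sub>R F) *v x)"
      using uv by simp
    moreover have "u *\<^sub>R E + v *\<^sub>R F \<in> contractions"
      using E uv unfolding C_iff by (intro convexD[OF convex_contractions]) auto
    ultimately show "u *\<^sub>R E + v *\<^sub>R F \<in> C x"
      unfolding C_iff by blast
  qed
  have scale: "C (c *\<^sub>R x) = C x" if "c \<noteq> 0" for c x
    using that by (auto simp: C_def matrix_mult_scaleR_vec)
  define B where "B x y = (A *v x) \<bullet> (A *v y) - r\<^sup>2 * (x \<bullet> y)" for x y
  have B_nonpos: "B x x \<le> 0 \<longleftrightarrow> norm (A *v x) \<le> r * norm x" for x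
  proof -
    have "B x x = (norm (A *v x))\<^sup>2 - (r * norm x)\<^sup>2"
      by (simp add: B_def dot_square_norm power_mult_distrib)
    then show ?thesis using r by (simp add: power2_le_iff_abs_le)
  qed
  define R where "R x = rank_one_map x ((- 1 / r) *\<^sub>R (A *v x))" for x
  have R_in: "R x \<in> C x" if "x \<noteq> 0" "B x x \<le> 0" for x
    using that r rank_one_map_self[of x] B_nonpos[of x]
    by (auto simp: C_iff R_def field_simps intro!: rank_one_map_contraction)
  have key: "connected_component ?S E F"
    if xy: "x \<noteq> 0" "y \<noteq> 0" and EF: "E \<in> C x" "F \<in> C y" and Bxy: "B x y \<le> 0" for x y E F
  proof (cases "0 \<in> closed_segment x y")
    case True
    then obtain t where t: "0 = (1 - t) *\<^sub>R x + t *\<^sub>R y"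
      by (auto simp: in_segment)
    then have "t \<noteq> 0" "t \<noteq> 1" using xy by auto
    have "t *\<^sub>R y = (t - 1) *\<^sub>R x" using t by (simp add: algebra_simps)
    then have "C y = C x"
      using scale[of t y] scale[of "t - 1" x] \<open>t \<noteq> 0\<close> \<open>t \<noteq> 1\<close> by simp
    then show ?thesis
      using EF C_conn[of x] C_sub[OF xy(1)] by (auto simp: connected_component_def)
  next
    case False
    have Bx: "B x x \<le> 0" "B y y \<le> 0"
      using EF r unfolding B_nonpos C_iff contractions_def by (auto simp: mult_left_mono)
    have seg: "z \<noteq> 0 \<and> B z z \<le> 0" if "z \<in> closed_segment x y" for z
    proof -
      obtain t where t: "0 \<le> t" "t \<le> 1" "z = (1 - t) *\<^sub>R x + t *\<^sub>R y"
        using \<open>z \<in> closed_segment x y\<close> by (auto simp: in_segment)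
      have "B z z = (1 - t)\<^sup>2 * B x x + t\<^sup>2 * B y y + 2 * (t * (1 - t)) * B x y"
        unfolding t(3) B_def
        by (simp add: matrix_vector_right_distrib matrix_mult_scaleR_vec inner_simps inner_commute[of y x]
            inner_commute[of "A *v y" "A *v x"] power2_eq_square algebra_simps)
      also have "\<dots> \<le> 0"
        using Bx Bxy t by (intro add_nonpos_nonpos mult_nonneg_nonpos) auto
      finally show ?thesis using False that by auto
    qed
    have "continuous_on (closed_segment x y) R"
      unfolding R_def rank_one_map_def
      by (intro continuous_on_vec_lambda continuous_intros matrix_vector_mult_linear_continuous_on)
        (use seg in auto)
    then have "connected (R ` closed_segment x y)"
      by (rule connected_continuous_image) simp
    moreover have "R ` closed_segment x y \<subseteq> ?S"
      using seg R_in C_sub by blast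
    ultimately have "connected_component ?S (R x) (R y)"
      by (auto simp: connected_component_def)
    moreover have "connected_component ?S E (R x)"
      using EF C_conn C_sub[OF xy(1)] R_in[OF xy(1) Bx(1)] unfolding connected_component_def by blast
    moreover have "connected_component ?S (R y) F"
      using EF C_conn C_sub[OF xy(2)] R_in[OF xy(2) Bx(2)] unfolding connected_component_def by blast
    ultimately show ?thesis by (meson connected_component_trans)
  qed
  have "connected_component ?S E F" if EF: "E \<in> ?S" "F \<in> ?S" for E F
  proof -
    obtain x y where xy: "x \<noteq> 0" "y \<noteq> 0" "E \<in> C x" "F \<in> C y"
      using EF by (auto simp: singular_iff_kernel C_def)
    show ?thesis
    proof (cases "B x y \<le> 0")
      case True
      then show ?thesis using key xy by blast
    next
      case False
      have "F \<in> C (- y)" using scale[of "-1" y] xy by simp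
      moreover have "B x (- y) \<le> 0"
        using False matrix_mult_scaleR_vec[of A "-1" y] by (simp add: B_def)
      ultimately show ?thesis using key[of x "- y"] xy by simp
    qed
  qed
  then show ?thesis by (auto simp: connected_iff_connected_component)
qed

section \<open>Matrix polynomials and their eigenvalues\<close>

lemma matpoly_eval_of_coeffs:
  "matpoly_eval (matpoly_of_coeffs m C) z = (\<chi> i k. \<Sum>j\<le>m. C j $ i $ k * z ^ j)"
  by (simp add: matpoly_eval_def matpoly_of_coeffs_def vec_eq_iff poly_sum poly_monom)

lemma matpoly_eigenvalue_iff: "matpoly_eigenvalue Q z \<longleftrightarrow> poly (det Q) z = 0"
  by (simp add: matpoly_eigenvalue_def poly_det)

lemma root_count_ge_order:
  assumes "p \<noteq> 0" "z \<in> S" "poly p z = 0"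
  shows "order z p \<le> root_count p S"
  unfolding root_count_def
  by (rule member_le_sum) (use assms poly_roots_finite[OF assms(1)] in simp_all)

lemma root_count_eq_0_iff:
  assumes "p \<noteq> 0"
  shows "root_count p S = 0 \<longleftrightarrow> (\<forall>z\<in>S. poly p z \<noteq> 0)"
proof -
  have fin: "finite {z. z \<in> S \<and> poly p z = 0}"
    using poly_roots_finite[OF assms] by simp
  show ?thesis
    unfolding root_count_def sum_eq_0_iff[OF fin] using assms by (auto simp: order_root)
qed

lemma sum_enat: "(\<Sum>x\<in>A. enat (f x)) = enat (\<Sum>x\<in>A. f x)"
  by (induction A rule: infinite_finite_induct) (auto simp: zero_enat_def)

lemma num_eigenvalues_in_eq_root_count:
  assumes "det Q \<noteq> 0"
  shows "num_eigenvalues_in Q S = enat (root_count (det Q) S)"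
  using assms
  by (simp add: num_eigenvalues_in_def alg_multiplicity_def root_count_def matpoly_eigenvalue_iff sum_enat)

lemma multiple_eigenvalue_iff:
  assumes "det Q \<noteq> 0"
  shows "multiple_eigenvalue Q z \<longleftrightarrow> order z (det Q) \<ge> 2"
proof -
  have "2 \<le> enat n \<longleftrightarrow> 2 \<le> n" for n
    by (metis enat_ord_simps(1) numeral_eq_enat)
  moreover have "poly (det Q) z = 0" if "order z (det Q) \<ge> 2"
    using that assms by (simp add: order_root)
  ultimately show ?thesis
    using assms by (auto simp: multiple_eigenvalue_def alg_multiplicity_def matpoly_eigenvalue_iff)
qed

section \<open>Perturbations and the pseudospectrum\<close>

locale weighted_perturbations =
  fixes m :: nat and P :: "nat \<Rightarrow> complex ^ 'n ^ 'n" and w :: "nat \<Rightarrow> real" and \<epsilon> :: real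
  assumes w_0: "w 0 > 0"
    and w_nonneg: "\<And>j. j \<le> m \<Longrightarrow> w j \<ge> 0"
    and eps: "\<epsilon> > 0"
    and bounded_spectrum: "bounded (pseudospectrum m P \<epsilon> w)"
begin

abbreviation "P_poly \<equiv> matpoly_of_coeffs m P"
abbreviation "\<Lambda> \<equiv> pseudospectrum m P \<epsilon> w"

text \<open>
  The value \<open>\<epsilon> w(\<bar>z\<bar>)\<close>: the perturbations of \<open>P\<close> change the matrix \<open>P(z)\<close> by a
  matrix of norm at most this number, and every such matrix occurs.
\<close>

definition radius :: "complex \<Rightarrow> real" where
  "radius z = \<epsilon> * (\<Sum>j\<le>m. w j * cmod z ^ j)"

lemma radius_pos: "radius z > 0"
proof -
  have "(\<Sum>j\<le>m. w j * cmod z ^ j) \<ge> w 0 * cmod z ^ 0"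
    by (rule member_le_sum) (auto simp: w_nonneg)
  then show ?thesis using w_0 eps by (simp add: radius_def)
qed

lemma P_in_perturbations: "P_poly \<in> perturbations m P \<epsilon> w"
  unfolding perturbations_def
  by (rule CollectI, rule exI[of _ "\<lambda>_. 0"])
    (use eps w_nonneg in \<open>auto simp: spectral_norm_le_iff\<close>)

lemma det_root_in_spectrum:
  "Q \<in> perturbations m P \<epsilon> w \<Longrightarrow> poly (det Q) z = 0 \<Longrightarrow> z \<in> \<Lambda>"
  by (auto simp: pseudospectrum_def matpoly_eigenvalue_iff)

lemma det_nonzero: "det Q \<noteq> 0" if "Q \<in> perturbations m P \<epsilon> w"
proof
  assume "det Q = 0"
  then have "\<Lambda> = UNIV" using det_root_in_spectrum[OF that] by auto
  then show False using bounded_spectrum not_bounded_UNIV by metis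
qed

text \<open>
  The phase that makes all terms \<open>w\<^sub>j u\<^sup>j z\<^sup>j\<close> nonnegative is \<open>u = \<bar>z\<bar> / z\<close>, which does not depend
  polynomially on \<open>z\<close>. With \<open>u\<close> as a parameter of its own the result is a matrix polynomial, and with \<open>u\<close>
  ranging over the whole disc, not only the circle, the set of parameters is convex.
\<close>

definition twisted_perturbation :: "(complex ^ 'n ^ 'n) \<times> complex \<Rightarrow> 'n matpoly" where
  "twisted_perturbation x =
     matpoly_of_coeffs m (\<lambda>j. P j + (\<chi> i k. (of_real (\<epsilon> * w j) * snd x ^ j) * fst x $ i $ k))"

lemma twisted_perturbation_in_perturbations:
  assumes "x \<in> contractions \<times> cball 0 1"
  shows "twisted_perturbation x \<in> perturbations m P \<epsilon> w"
proof -
  have bound: "norm ((\<chi> i k. (of_real (\<epsilon> * w j) * snd x ^ j) * fst x $ i $ k) *v v) \<le> \<epsilon> * w j * norm v"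
    if "j \<le> m" for j v
  proof -
    have 1: "cmod (snd x) \<le> 1" "norm (fst x *v v) \<le> norm v"
      using assms by (auto simp: contractions_def mem_Times_iff)
    have "norm ((\<chi> i k. (of_real (\<epsilon> * w j) * snd x ^ j) * fst x $ i $ k) *v v)
        = (\<epsilon> * w j) * (cmod (snd x) ^ j * norm (fst x *v v))"
      using eps w_nonneg[OF that]
      by (simp only: matrix_vector_cmult norm_cmult_vec) (simp add: norm_mult norm_power)
    also have "\<dots> \<le> (\<epsilon> * w j) * (1 * norm v)"
      using 1 eps w_nonneg[OF that]
      by (intro mult_left_mono mult_mono) (auto simp: power_le_one)
    finally show ?thesis by simp
  qed
  show ?thesis
    unfolding perturbations_def twisted_perturbation_def spectral_norm_le_iff
    by (intro CollectI exI conjI, rule refl) (use bound in blast)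
qed

lemma twisted_perturbation_zero: "twisted_perturbation (0, u) = P_poly"
  by (simp add: twisted_perturbation_def flip: zero_vec_def)

lemma twisted_perturbation_eval:
  assumes "u * z = of_real (cmod z)"
  shows "matpoly_eval (twisted_perturbation (E, u)) z = matpoly_eval P_poly z + radius z *\<^sub>R E"
proof -
  have "(\<Sum>j\<le>m. (P j $ i $ k + (of_real (\<epsilon> * w j) * u ^ j) * E $ i $ k) * z ^ j)
      = (\<Sum>j\<le>m. P j $ i $ k * z ^ j) + radius z *\<^sub>R (E $ i $ k)" for i k
  proof -
    have "(\<Sum>j\<le>m. (P j $ i $ k + (of_real (\<epsilon> * w j) * u ^ j) * E $ i $ k) * z ^ j)
        = (\<Sum>j\<le>m. P j $ i $ k * z ^ j) + (\<Sum>j\<le>m. of_real (\<epsilon> * w j) * (u * z) ^ j * E $ i $ k)"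
      by (simp add: algebra_simps sum.distrib power_mult_distrib)
    also have "(\<Sum>j\<le>m. of_real (\<epsilon> * w j) * (u * z) ^ j * E $ i $ k) = radius z *\<^sub>R (E $ i $ k)"
      unfolding assms
      by (simp add: radius_def scaleR_conv_of_real sum_distrib_left sum_distrib_right mult.assoc)
    finally show ?thesis .
  qed
  then show ?thesis
    by (simp add: twisted_perturbation_def matpoly_eval_of_coeffs vec_eq_iff)
qed

lemma twist_exists: "\<exists>u. cmod u = 1 \<and> u * z = of_real (cmod z)"
proof (cases "z = 0")
  case False
  then show ?thesis
    by (intro exI[of _ "of_real (cmod z) / z"]) (simp add: norm_divide)
qed (auto intro: exI[of _ 1])

lemma continuous_on_twisted_det:
  "continuous_on S (\<lambda>(x, z). poly (det (twisted_perturbation x)) z)"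
  unfolding poly_det case_prod_unfold
  by (rule continuous_on_det)
    (auto simp: twisted_perturbation_def matpoly_eval_of_coeffs intro!: continuous_intros)

lemma perturbation_value_bound:
  assumes \<Delta>: "\<forall>j\<le>m. spectral_norm (\<Delta> j) \<le> \<epsilon> * w j"
  shows "norm (matpoly_eval (matpoly_of_coeffs m \<Delta>) z *v v) \<le> radius z * norm v"
proof -
  have "matpoly_eval (matpoly_of_coeffs m \<Delta>) z *v v = (\<Sum>j\<le>m. \<chi> i. z ^ j * (\<Delta> j *v v) $ i)"
  proof (rule vec_eq_iff[THEN iffD2], rule allI)
    fix i
    have "(matpoly_eval (matpoly_of_coeffs m \<Delta>) z *v v) $ i
        = (\<Sum>k\<in>UNIV. \<Sum>j\<le>m. \<Delta> j $ i $ k * z ^ j * v $ k)"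
      by (simp add: matpoly_eval_of_coeffs matrix_vector_mult_def sum_distrib_right)
    also have "\<dots> = (\<Sum>j\<le>m. \<Sum>k\<in>UNIV. \<Delta> j $ i $ k * z ^ j * v $ k)"
      by (rule sum.swap)
    also have "\<dots> = (\<Sum>j\<le>m. \<chi> i. z ^ j * (\<Delta> j *v v) $ i) $ i"
      by (simp add: matrix_vector_mult_def sum_distrib_left mult_ac)
    finally show "(matpoly_eval (matpoly_of_coeffs m \<Delta>) z *v v) $ i
        = (\<Sum>j\<le>m. \<chi> i. z ^ j * (\<Delta> j *v v) $ i) $ i" .
  qed
  then have "norm (matpoly_eval (matpoly_of_coeffs m \<Delta>) z *v v) \<le> (\<Sum>j\<le>m. cmod z ^ j * norm (\<Delta> j *v v))"
    using norm_sum[of "\<lambda>j. \<chi> i. z ^ j * (\<Delta> j *v v) $ i" "{..m}"]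
    by (simp add: norm_cmult_vec norm_power)
  also have "\<dots> \<le> (\<Sum>j\<le>m. cmod z ^ j * (\<epsilon> * w j * norm v))"
    using \<Delta> by (intro sum_mono mult_left_mono) (auto simp: spectral_norm_le_iff)
  also have "\<dots> = radius z * norm v"
    by (simp add: radius_def sum_distrib_left sum_distrib_right mult_ac)
  finally show ?thesis .
qed

text \<open>
  At a fixed point \<open>z\<close> only the sum \<open>\<Sum>j\<le>m. \<Delta>\<^sub>j z\<^sup>j\<close> matters, which is \<open>radius z\<close> times a contraction.
  Conversely, each contraction arises from a twisted perturbation whose phase is aligned with \<open>z\<close>.
\<close>

lemma spectrum_iff:
  "z \<in> \<Lambda> \<longleftrightarrow> (\<exists>E\<in>contractions. det (matpoly_eval P_poly z + radius z *\<^sub>R E) = 0)"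
proof
  assume "z \<in> \<Lambda>"
  then obtain \<Delta> where \<Delta>: "\<forall>j\<le>m. spectral_norm (\<Delta> j) \<le> \<epsilon> * w j"
    and sing: "det (matpoly_eval (matpoly_of_coeffs m (\<lambda>j. P j + \<Delta> j)) z) = 0"
    by (auto simp: pseudospectrum_def perturbations_def matpoly_eigenvalue_def)
  define E where "E = (1 / radius z) *\<^sub>R matpoly_eval (matpoly_of_coeffs m \<Delta>) z"
  have "E \<in> contractions"
    using perturbation_value_bound[OF \<Delta>, of z] radius_pos[of z]
    by (simp add: E_def contractions_def scaleR_matrix_mult_vec field_simps)
  moreover have "matpoly_eval P_poly z + radius z *\<^sub>R E
      = matpoly_eval (matpoly_of_coeffs m (\<lambda>j. P j + \<Delta> j)) z"
    using radius_pos[of z]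
    by (simp add: E_def matpoly_eval_of_coeffs vec_eq_iff algebra_simps sum.distrib)
  ultimately show "\<exists>E\<in>contractions. det (matpoly_eval P_poly z + radius z *\<^sub>R E) = 0"
    using sing by metis
next
  assume "\<exists>E\<in>contractions. det (matpoly_eval P_poly z + radius z *\<^sub>R E) = 0"
  then obtain E where E: "E \<in> contractions" "det (matpoly_eval P_poly z + radius z *\<^sub>R E) = 0"
    by blast
  obtain u where u: "cmod u = 1" "u * z = of_real (cmod z)"
    using twist_exists by blast
  have "twisted_perturbation (E, u) \<in> perturbations m P \<epsilon> w"
    using E u by (intro twisted_perturbation_in_perturbations) simp
  then show "z \<in> \<Lambda>"
    by (rule det_root_in_spectrum) (simp add: poly_det twisted_perturbation_eval[OF u(2)] E(2))
qed

section \<open>Eigenvalues of perturbations in a component\<close>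

lemma compact_spectrum: "compact \<Lambda>"
proof -
  obtain r where r: "\<Lambda> \<subseteq> cball 0 r"
    using bounded_spectrum by (auto simp: bounded_iff subset_iff)
  define S where "S = (contractions \<times> cball 0 r) \<inter>
    {x. det (matpoly_eval P_poly (snd x) + radius (snd x) *\<^sub>R fst x) = 0}"
  have "closed {x. det (matpoly_eval P_poly (snd x) + radius (snd x) *\<^sub>R fst x) = 0}"
    by (intro closed_Collect_eq continuous_on_det)
      (auto simp: matpoly_eval_of_coeffs radius_def intro!: continuous_intros)
  then have "compact S"
    unfolding S_def by (intro compact_Int_closed compact_Times compact_contractions) auto
  moreover have "continuous_on S snd" by (intro continuous_intros)
  ultimately have "compact (snd ` S)" by (metis compact_continuous_image)
  moreover have "snd ` S = \<Lambda>"
  proof (intro equalityI subsetI)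
    fix z assume z: "z \<in> \<Lambda>"
    then obtain E where E: "E \<in> contractions" "det (matpoly_eval P_poly z + radius z *\<^sub>R E) = 0"
      by (auto simp: spectrum_iff)
    then have "(E, z) \<in> S" using r z by (auto simp: S_def)
    then show "z \<in> snd ` S" by force
  qed (auto simp: S_def spectrum_iff)
  ultimately show ?thesis by simp
qed

lemma root_count_perturbation:
  assumes Q: "Q \<in> perturbations m P \<epsilon> w" and K: "K \<subseteq> \<Lambda>" "compact K" "closed (\<Lambda> - K)"
  shows "root_count (det Q) K = root_count (det P_poly) K"
proof -
  obtain \<Delta> where Q_eq: "Q = matpoly_of_coeffs m (\<lambda>j. P j + \<Delta> j)"
    and \<Delta>: "\<forall>j\<le>m. spectral_norm (\<Delta> j) \<le> \<epsilon> * w j"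
    using Q by (auto simp: perturbations_def)
  define q where "q t = matpoly_of_coeffs m (\<lambda>j. P j + t *\<^sub>R \<Delta> j)" for t :: real
  have q_in: "q t \<in> perturbations m P \<epsilon> w" if "t \<in> {0..1}" for t
  proof -
    have "norm ((t *\<^sub>R \<Delta> j) *v v) \<le> \<epsilon> * w j * norm v" if j: "j \<le> m" for j v
    proof -
      have "norm ((t *\<^sub>R \<Delta> j) *v v) \<le> 1 * norm (\<Delta> j *v v)"
        unfolding scaleR_matrix_mult_vec norm_scaleR using \<open>t \<in> {0..1}\<close>
        by (intro mult_right_mono) auto
      also have "\<dots> \<le> \<epsilon> * w j * norm v"
        using \<Delta> j by (simp add: spectral_norm_le_iff)
      finally show ?thesis .
    qed
    then show ?thesis
      unfolding perturbations_def q_def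
      by (intro CollectI exI[of _ "\<lambda>j. t *\<^sub>R \<Delta> j"]) (simp add: spectral_norm_le_iff)
  qed
  have "root_count (det (q 1)) K = root_count (det (q 0)) K"
  proof (rule root_count_constant[where D = "{0..1}" and p = "\<lambda>t. det (q t)"])
    show "continuous_on ({0..1} \<times> UNIV) (\<lambda>(t, z). poly (det (q t)) z)"
      unfolding poly_det case_prod_unfold
      by (rule continuous_on_det) (auto simp: q_def matpoly_eval_of_coeffs intro!: continuous_intros)
    show "\<forall>t\<in>{0..1}. {z. poly (det (q t)) z = 0} \<subseteq> K \<union> (\<Lambda> - K)"
      using det_root_in_spectrum[OF q_in] by blast
  qed (use K q_in det_nonzero in auto)
  then show ?thesis by (simp add: q_def Q_eq)
qed

text \<open>
  The set \<open>C\<close> need not be relatively open in \<open>\<Lambda>\<close> a priori, but if it avoided the finitely many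
  eigenvalues of \<open>P\<close>, then by the Sura-Bura theorem so would a compact, relatively open set \<open>K \<supseteq> C\<close>. The
  count in \<open>K\<close> would be \<open>0\<close> for \<open>P\<close> and positive for a perturbation with an eigenvalue in \<open>C\<close>.
\<close>

lemma component_contains_eigenvalue:
  assumes C: "C \<in> components \<Lambda>"
  shows "\<exists>z\<in>C. poly (det P_poly) z = 0"
proof (rule ccontr)
  assume no: "\<not> ?thesis"
  define U where "U = - {z. poly (det P_poly) z = 0}"
  have "open U"
    using poly_roots_finite[OF det_nonzero[OF P_in_perturbations]]
    unfolding U_def by (intro open_Compl finite_imp_closed)
  moreover have "C \<subseteq> U" using no by (auto simp: U_def)
  moreover have "compact C"
    using C compact_spectrum compact_components by blast
  moreover have "locally compact \<Lambda>"
    using compact_spectrum by (simp add: closed_imp_locally_compact compact_imp_closed)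
  ultimately obtain K where K: "openin (top_of_set \<Lambda>) K" "compact K" "C \<subseteq> K" "K \<subseteq> U"
    using Sura_Bura_clopen_subset C by metis
  obtain z where z: "z \<in> C" using C in_components_nonempty by blast
  then have "z \<in> \<Lambda>" using C in_components_subset by blast
  then obtain Q where Q: "Q \<in> perturbations m P \<epsilon> w" "poly (det Q) z = 0"
    by (auto simp: pseudospectrum_def matpoly_eigenvalue_iff)
  have "closedin (top_of_set \<Lambda>) (\<Lambda> - K)"
    using K(1) by (simp add: closedin_def openin_imp_subset double_diff)
  then have "closed (\<Lambda> - K)"
    using compact_spectrum compact_imp_closed closedin_closed_trans by blast
  then have "root_count (det Q) K = root_count (det P_poly) K"
    using K Q openin_imp_subset[OF K(1)] by (intro root_count_perturbation) auto
  moreover have "root_count (det P_poly) K = 0"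
    using K(4) det_nonzero[OF P_in_perturbations] by (auto simp: root_count_eq_0_iff U_def)
  moreover have "root_count (det Q) K \<noteq> 0"
    using z K(3) Q det_nonzero[OF Q(1)] by (auto simp: root_count_eq_0_iff)
  ultimately show False by simp
qed

lemma finite_components: "finite (components \<Lambda>)"
proof (rule finite_subset)
  show "components \<Lambda> \<subseteq> connected_component_set \<Lambda> ` {z. poly (det P_poly) z = 0}"
  proof
    fix C assume C: "C \<in> components \<Lambda>"
    obtain z where z: "z \<in> C" "poly (det P_poly) z = 0"
      using component_contains_eigenvalue[OF C] by blast
    then have "C = connected_component_set \<Lambda> z"
      using C by (metis components_iff connected_component_eq)
    then show "C \<in> connected_component_set \<Lambda> ` {z. poly (det P_poly) z = 0}"
      using z by blast
  qed
qed (use poly_roots_finite[OF det_nonzero[OF P_in_perturbations]] in simp)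

lemma closed_component_complement:
  assumes "C \<in> components \<Lambda>"
  shows "closed (\<Lambda> - C)"
proof -
  have "\<Lambda> - C = \<Union>(components \<Lambda> - {C})"
    using assms components_eq[of _ \<Lambda>] Union_components[of \<Lambda>] by blast
  moreover have "closed (\<Union>(components \<Lambda> - {C}))"
    using finite_components compact_spectrum by (intro closed_Union) (auto intro: closed_components compact_imp_closed)
  ultimately show ?thesis by simp
qed


section \<open>Simple eigenvalues and monodromy\<close>

lemma twisted_family_covering:
  assumes G: "G \<in> components \<Lambda>"
    and simple: "\<And>Q z. Q \<in> perturbations m P \<epsilon> w \<Longrightarrow> z \<in> G \<Longrightarrow> \<not> multiple_eigenvalue Q z"
  shows "covering_space (root_bundle (\<lambda>x. det (twisted_perturbation x)) (contractions \<times> cball 0 1) G)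
    fst (contractions \<times> cball 0 1)"
proof (rule covering_space_root_bundle)
  let ?D = "contractions \<times> cball 0 1"
  note pert = twisted_perturbation_in_perturbations
  have G': "compact G" "G \<subseteq> \<Lambda>" "closed (\<Lambda> - G)"
    using compact_components[OF compact_spectrum G] in_components_subset[OF G] closed_component_complement[OF G]
    by auto
  show "compact G" "closed (\<Lambda> - G)" "G \<inter> (\<Lambda> - G) = {}" using G' by auto
  show "continuous_on (?D \<times> UNIV) (\<lambda>(x, z). poly (det (twisted_perturbation x)) z)"
    by (rule continuous_on_twisted_det)
  show "\<forall>x\<in>?D. {z. poly (det (twisted_perturbation x)) z = 0} \<subseteq> G \<union> (\<Lambda> - G)"
    using det_root_in_spectrum[OF pert] by blast
  show nz: "det (twisted_perturbation x) \<noteq> 0" if "x \<in> ?D" for x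
    using det_nonzero[OF pert[OF that]] .
  show "order z (det (twisted_perturbation x)) = 1"
    if xz: "(x, z) \<in> root_bundle (\<lambda>x. det (twisted_perturbation x)) ?D G" for x z
  proof -
    have x: "x \<in> ?D" "z \<in> G" "poly (det (twisted_perturbation x)) z = 0"
      using xz by (auto simp: root_bundle_def)
    have "\<not> order z (det (twisted_perturbation x)) \<ge> 2"
      using simple[OF pert[OF x(1)] x(2)] multiple_eigenvalue_iff[OF nz[OF x(1)]] by simp
    moreover have "order z (det (twisted_perturbation x)) \<noteq> 0"
      using x(3) nz[OF x(1)] by (simp add: order_root)
    ultimately show ?thesis by simp
  qed
  show "\<exists>z\<in>G. poly (det (twisted_perturbation x)) z = 0" if x: "x \<in> ?D" for x
  proof (rule ccontr)
    assume "\<not> ?thesis"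
    then have "root_count (det (twisted_perturbation x)) G = 0"
      by (simp add: root_count_eq_0_iff[OF nz[OF x]])
    then have "root_count (det P_poly) G = 0"
      using root_count_perturbation[OF pert[OF x] G'(2,1,3)] by simp
    then show False
      using component_contains_eigenvalue[OF G]
      by (simp add: root_count_eq_0_iff[OF det_nonzero[OF P_in_perturbations]])
  qed
qed

text \<open>
  Each \<open>z \<in> G\<close> occurs here only with the phases \<open>u\<close> for which the perturbation at \<open>z\<close> has its full
  size \<open>radius z\<close>: one phase if \<open>z \<noteq> 0\<close>, and the whole circle if \<open>z = 0\<close>. This is what makes the fibres
  over \<open>G\<close> connected.
\<close>

definition aligned_roots :: "complex set \<Rightarrow> (((complex ^ 'n ^ 'n) \<times> complex) \<times> complex) set" where
  "aligned_roots G = {((E, u), z). E \<in> contractions \<and> cmod u = 1 \<and> u * z = of_real (cmod z) \<and>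
     z \<in> G \<and> poly (det (twisted_perturbation (E, u))) z = 0}"

lemma aligned_roots_subset:
  "aligned_roots G \<subseteq> root_bundle (\<lambda>x. det (twisted_perturbation x)) (contractions \<times> cball 0 1) G"
  by (auto simp: aligned_roots_def root_bundle_def)

text \<open>
  The projection to \<open>G\<close> is a closed map, by compactness, onto a connected set, and its fibres are
  products of connected sets.
\<close>

lemma connected_aligned_roots:
  assumes G: "G \<in> components \<Lambda>"
  shows "connected (aligned_roots G)"
proof -
  have "compact G" using G compact_spectrum compact_components by blast
  have "closed {y. snd (fst y) * snd y = of_real (cmod (snd y)) \<and>
      poly (det (twisted_perturbation (fst y))) (snd y) = 0}" (is "closed ?Z")
    using continuous_on_twisted_det[of UNIV]
    by (intro closed_Collect_conj closed_Collect_eq) (auto simp: case_prod_unfold intro!: continuous_intros)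
  moreover have "aligned_roots G = ((contractions \<times> sphere 0 1) \<times> G) \<inter> ?Z"
    by (auto simp: aligned_roots_def)
  ultimately have comp: "compact (aligned_roots G)"
    using \<open>compact G\<close> by (simp add: compact_Int_closed compact_Times compact_contractions)
  have cont: "continuous_on (aligned_roots G) snd" by (intro continuous_intros)
  have img: "snd ` aligned_roots G = G"
  proof (intro equalityI subsetI)
    fix z assume z: "z \<in> G"
    then have "z \<in> \<Lambda>" using G in_components_subset by blast
    then obtain E where E: "E \<in> contractions" "det (matpoly_eval P_poly z + radius z *\<^sub>R E) = 0"
      by (auto simp: spectrum_iff)
    obtain u where u: "cmod u = 1" "u * z = of_real (cmod z)"
      using twist_exists by blast
    have "((E, u), z) \<in> aligned_roots G"
      using E u z by (simp add: aligned_roots_def poly_det twisted_perturbation_eval)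
    then show "z \<in> snd ` aligned_roots G" by force
  qed (auto simp: aligned_roots_def)
  have closed_map: "closedin (top_of_set G) (snd ` C)"
    if "closedin (top_of_set (aligned_roots G)) C" for C
  proof -
    have "compact C" "C \<subseteq> aligned_roots G"
      using that comp closedin_compact closedin_imp_subset by blast+
    then have "compact (snd ` C)" "snd ` C \<subseteq> G"
      using cont img by (auto intro: compact_continuous_image continuous_on_subset)
    then show ?thesis by (simp add: closed_subset compact_imp_closed)
  qed
  have fibre: "connected (aligned_roots G \<inter> snd -` {z})" if z: "z \<in> G" for z
  proof -
    have "connected {u. cmod u = 1 \<and> u * z = of_real (cmod z)}"
    proof (cases "z = 0")
      case True
      then have "{u. cmod u = 1 \<and> u * z = of_real (cmod z)} = sphere 0 1" by auto
      then show ?thesis by (simp add: connected_sphere)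
    next
      case False
      then have "{u. cmod u = 1 \<and> u * z = of_real (cmod z)} = {of_real (cmod z) / z}"
        by (auto simp: field_simps norm_divide)
      then show ?thesis by simp
    qed
    moreover have split: "aligned_roots G \<inter> snd -` {z} =
      ({E \<in> contractions. det (matpoly_eval P_poly z + radius z *\<^sub>R E) = 0}
        \<times> {u. cmod u = 1 \<and> u * z = of_real (cmod z)}) \<times> {z}"
      using z by (auto simp: aligned_roots_def poly_det twisted_perturbation_eval)
    ultimately show ?thesis
      unfolding split
      by (intro connected_Times connected_singular_contractions[OF radius_pos] connected_sing)
  qed
  have "connected (aligned_roots G \<inter> snd -` G)"
    by (rule connected_closed_monotone_preimage[OF cont img closed_map fibre])
      (use G in_components_connected in auto)
  moreover have "aligned_roots G \<inter> snd -` G = aligned_roots G" using img by auto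
  ultimately show ?thesis by simp
qed

text \<open>
  On \<open>aligned_roots G\<close> both the identity and the composite of the projection with a global section \<open>g\<close> lift
  the projection to the parameters. They agree at one point over \<open>E = 0\<close>, hence everywhere.
\<close>

lemma eigenvalue_unique_if_all_simple:
  assumes G: "G \<in> components \<Lambda>"
    and simple: "\<And>Q z. Q \<in> perturbations m P \<epsilon> w \<Longrightarrow> z \<in> G \<Longrightarrow> \<not> multiple_eigenvalue Q z"
    and z: "z1 \<in> G" "poly (det P_poly) z1 = 0" "z2 \<in> G" "poly (det P_poly) z2 = 0"
  shows "z1 = z2"
proof -
  let ?D = "(contractions :: (complex ^ 'n ^ 'n) set) \<times> cball (0 :: complex) 1"
  let ?X = "root_bundle (\<lambda>x. det (twisted_perturbation x)) ?D G"
  have cov: "covering_space ?X fst ?D"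
    by (rule twisted_family_covering[OF G simple])
  have "convex ?D" by (intro convex_Times convex_contractions convex_cball)
  then have sc: "simply_connected ?D" "locally path_connected ?D"
    by (auto intro: convex_imp_simply_connected convex_imp_locally_path_connected)
  have id: "continuous_on ?D (\<lambda>x. x)" "(\<lambda>x. x) \<in> ?D \<rightarrow> ?D" by auto
  obtain g where g: "continuous_on ?D g" "g \<in> ?D \<rightarrow> ?X" "\<And>x. x \<in> ?D \<Longrightarrow> fst (g x) = x"
    using covering_space_lift[OF cov sc id] by blast
  \<comment> \<open>For \<open>E = 0\<close> the section picks an eigenvalue of \<open>P\<close>, which depends continuously on \<open>u\<close> and so not at all.\<close>
  define h where "h u = snd (g (0, u))" for u
  have h: "h u \<in> G \<and> poly (det P_poly) (h u) = 0" if "u \<in> cball 0 1" for u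
  proof -
    have x: "(0, u) \<in> ?D" using that by (simp add: zero_in_contractions)
    then have "g (0, u) \<in> ?X" using g(2) by blast
    then show ?thesis
      using g(3)[OF x] by (auto simp: root_bundle_def h_def twisted_perturbation_zero)
  qed
  have "h constant_on cball 0 1"
  proof (rule continuous_finite_range_constant)
    show "continuous_on (cball 0 1) h"
      unfolding h_def
      by (intro continuous_intros continuous_on_compose2[OF g(1)]) (auto simp: zero_in_contractions)
    have "h ` cball 0 1 \<subseteq> {z. poly (det P_poly) z = 0}" using h by auto
    then show "finite (h ` cball 0 1)"
      using poly_roots_finite[OF det_nonzero[OF P_in_perturbations]] finite_subset by blast
  qed simp
  then obtain \<mu> where \<mu>: "\<And>u. u \<in> cball 0 1 \<Longrightarrow> h u = \<mu>"
    by (auto simp: constant_on_def)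
  have "\<mu> \<in> G" "poly (det P_poly) \<mu> = 0" using h[of 0] \<mu>[of 0] by auto
  have root_aligned: "\<exists>u. u \<in> cball 0 1 \<and> ((0, u), y) \<in> aligned_roots G"
    if "y \<in> G" "poly (det P_poly) y = 0" for y
  proof -
    obtain u where "cmod u = 1" "u * y = of_real (cmod y)"
      using twist_exists by blast
    then show ?thesis
      using that
      by (intro exI[of _ u]) (simp add: aligned_roots_def zero_in_contractions twisted_perturbation_zero)
  qed
  obtain u where u: "u \<in> cball 0 1" "((0, u), \<mu>) \<in> aligned_roots G"
    using root_aligned \<open>\<mu> \<in> G\<close> \<open>poly (det P_poly) \<mu> = 0\<close> by blast
  have on_section: "y = g (fst y)" if y: "y \<in> aligned_roots G" for y
  proof (rule covering_space_lift_unique[OF cov, where f = fst and T = "aligned_roots G"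
        and a = "((0, u), \<mu>)" and ?g1.0 = "\<lambda>y. y" and ?g2.0 = "\<lambda>y. g (fst y)"])
    have D: "fst y \<in> ?D" if "y \<in> aligned_roots G" for y
      using that by (auto simp: aligned_roots_def)
    have "(0, u) \<in> ?D" using u(1) by (simp add: zero_in_contractions)
    from g(3)[OF this] show "((0, u), \<mu>) = g (fst ((0, u), \<mu>))"
      using \<mu>[OF u(1)] by (auto simp: h_def prod_eq_iff)
    show "continuous_on (aligned_roots G) (\<lambda>y. g (fst y))"
      by (intro continuous_on_compose2[OF g(1)] continuous_intros) (use D in auto)
    show "fst \<in> aligned_roots G \<rightarrow> ?D" using D by blast
    show "(\<lambda>y. y) \<in> aligned_roots G \<rightarrow> ?X" using aligned_roots_subset by blast
    show "(\<lambda>y. g (fst y)) \<in> aligned_roots G \<rightarrow> ?X" using D g(2) by blast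
    show "fst y = fst (g (fst y))" if "y \<in> aligned_roots G" for y
      using g(3)[OF D[OF that]] by simp
  qed (use connected_aligned_roots[OF G] u y in \<open>auto intro!: continuous_intros\<close>)
  have "y = \<mu>" if y: "y \<in> G" "poly (det P_poly) y = 0" for y
  proof -
    obtain v where v: "v \<in> cball 0 1" "((0, v), y) \<in> aligned_roots G"
      using root_aligned[OF y] by blast
    then have "y = h v" using on_section[OF v(2)] by (metis fst_conv h_def snd_conv)
    then show ?thesis using \<mu>[OF v(1)] by simp
  qed
  then show ?thesis using z by blast
qed

theorem num_eigenvalues_gt_1_iff:
  assumes G: "G \<in> components \<Lambda>"
  shows "num_eigenvalues_in P_poly G > 1 \<longleftrightarrow>
    (\<exists>Q \<in> perturbations m P \<epsilon> w. \<exists>\<mu> \<in> G. multiple_eigenvalue Q \<mu>)"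
proof -
  have P_nz: "det P_poly \<noteq> 0" by (rule det_nonzero[OF P_in_perturbations])
  have "num_eigenvalues_in P_poly G > 1 \<longleftrightarrow> root_count (det P_poly) G > 1"
    by (simp add: num_eigenvalues_in_eq_root_count[OF P_nz] one_enat_def)
  also have "\<dots> \<longleftrightarrow> (\<exists>Q \<in> perturbations m P \<epsilon> w. \<exists>\<mu> \<in> G. multiple_eigenvalue Q \<mu>)"
  proof
    assume "\<exists>Q \<in> perturbations m P \<epsilon> w. \<exists>\<mu> \<in> G. multiple_eigenvalue Q \<mu>"
    then obtain Q \<mu> where Q: "Q \<in> perturbations m P \<epsilon> w" "\<mu> \<in> G" "multiple_eigenvalue Q \<mu>"
      by blast
    have nz: "det Q \<noteq> 0" by (rule det_nonzero[OF Q(1)])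
    have "2 \<le> order \<mu> (det Q)" using Q(3) multiple_eigenvalue_iff[OF nz] by simp
    also have "\<dots> \<le> root_count (det Q) G"
      using Q(2,3) nz by (intro root_count_ge_order) (auto simp: multiple_eigenvalue_def matpoly_eigenvalue_iff)
    also have "\<dots> = root_count (det P_poly) G"
      by (intro root_count_perturbation Q(1) in_components_subset[OF G]
          compact_components[OF compact_spectrum G] closed_component_complement[OF G])
    finally show "root_count (det P_poly) G > 1" by simp
  next
    assume many: "root_count (det P_poly) G > 1"
    show "\<exists>Q \<in> perturbations m P \<epsilon> w. \<exists>\<mu> \<in> G. multiple_eigenvalue Q \<mu>"
    proof (rule ccontr)
      assume "\<not> ?thesis"
      then have simple: "\<not> multiple_eigenvalue Q z" if "Q \<in> perturbations m P \<epsilon> w" "z \<in> G" for Q z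
        using that by blast
      obtain z where z: "z \<in> G" "poly (det P_poly) z = 0"
        using component_contains_eigenvalue[OF G] by blast
      have "{y. y \<in> G \<and> poly (det P_poly) y = 0} = {z}"
        using eigenvalue_unique_if_all_simple[OF G simple] z by blast
      then have "root_count (det P_poly) G = order z (det P_poly)"
        by (simp add: root_count_def)
      then have "multiple_eigenvalue P_poly z"
        using many multiple_eigenvalue_iff[OF P_nz] by simp
      then show False using simple[OF P_in_perturbations z(1)] by blast
    qed
  qed
  finally show ?thesis .
qed

end

theorem theorem19:
  fixes P :: "nat \<Rightarrow> complex ^ 'n ^ 'n" and m :: nat
    and w :: "nat \<Rightarrow> real" and \<epsilon> :: real and G :: "complex set"
  assumes "m \<ge> 1"
    and "det (P m) \<noteq> 0"
    and "w 0 > 0"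
    and "\<And>j. 1 \<le> j \<Longrightarrow> j \<le> m \<Longrightarrow> w j \<ge> 0"
    and "\<epsilon> > 0"
    and "bounded (pseudospectrum m P \<epsilon> w)"
    and "G \<in> components (pseudospectrum m P \<epsilon> w)"
  shows "num_eigenvalues_in (matpoly_of_coeffs m P) G > 1 \<longleftrightarrow>
    (\<exists>Q \<in> perturbations m P \<epsilon> w. \<exists>\<mu> \<in> G. multiple_eigenvalue Q \<mu>)"
proof -
  have "w j \<ge> 0" if "j \<le> m" for j
    using assms(3) assms(4)[of j] that by (cases "j = 0") auto
  then interpret weighted_perturbations m P w \<epsilon>
    using assms by unfold_locales auto
  show ?thesis by (rule num_eigenvalues_gt_1_iff[OF assms(7)])
qed

end
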